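(* Let $(a,c)\in\mathbb R\times\mathbb R$, $f\in\mathcal S(\mathbb R)$, and for $k=0,1$ set $$F_k(f;s,a,c):=\Phi_k(f;s,a,c)+(-1)^k e^{-\pi i a}\Phi_k(\mathcal F f;1-s,1-c,a).$$ These are meromorphic functions of $s$ with the following properties. (i) $F_1(f;s,a,c)$ is an entire function of $s$ for all $(a,c)\in\mathbb R\times\mathbb R$. $F_0(f;s,a,c)$ is an entire function of $s$ when both $a$ and $c$ are non-integers; otherwise it is meromorphic with possible simple poles at $s=0,1$. A pole may occur at $s=0$ only if $c$ is an integer, and at $s=1$ only if $a$ is an integer, with residues $$\mathrm{Res}_{s=0}F_0(f;s,a,c)=-2e^{-\pi i ac}f(0)\ \text{ if } c\in\mathbb Z,\qquad \mathrm{Res}_{s=1}F_0(f;s,a,c)=2e^{\pi i ac}\mathcal F f(0)\ \text{ if } a\in\mathbb Z.$$ (ii) $F_k(f;s,a+1,c)=e^{\pi i c}F_k(f;s,a,c)$ and $F_k(f;s,a,c+1)=e^{-\pi i a}F_k(f;s,a,c)$. (iii) $F_k(f;s,a,c)=(-1)^k e^{-\pi i a}F_k(\mathcal F f;1-s,1-c,a)$.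
   Context: $\mathcal S(\mathbb R)$ is the Schwartz space and $\mathcal F f(y)=\int_{-\infty}^\infty e^{-2\pi i xy}f(x)\,dx$. Let $\delta_{\mathbb Z}(c)=1$ if $c\in\mathbb Z$ and $0$ otherwise. For $k\in\{0,1\}$, real $a,c$ and $s\in\mathbb C$, $$\Phi_k(f;s,a,c):=\int_1^\infty\Big(\sum_{n\in\mathbb Z,\,n\neq -c}e^{2\pi i a(n+\frac c2)}f((n+c)x)\Big)x^{s-1}dx$$ $$\quad+(-1)^k e^{-\pi i(a+1-c)}\int_1^\infty\Big(\sum_{m\in\mathbb Z,\,m\ne c-1}e^{2\pi i(1-a)(m+\frac{1-c}{2})}f((m+1-c)x)\Big)x^{s-1}dx-\delta_{\mathbb Z}(c)e^{-\pi i ac}(1+(-1)^k)f(0)\frac1s.$$ *)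

theory Defs
  imports "HOL-Complex_Analysis.Complex_Analysis"
begin

definition nth_vderiv :: "nat \<Rightarrow> (real \<Rightarrow> complex) \<Rightarrow> real \<Rightarrow> complex" where
  "nth_vderiv n f = ((\<lambda>g x. vector_derivative g (at x)) ^^ n) f"

definition schwartz :: "(real \<Rightarrow> complex) set" where
  "schwartz = {f. (\<forall>n x. nth_vderiv n f differentiable (at x)) \<and>
                  (\<forall>m n. bounded (range (\<lambda>x. x ^ m *\<^sub>R nth_vderiv n f x)))}"

definition fourier :: "(real \<Rightarrow> complex) \<Rightarrow> real \<Rightarrow> complex" where
  "fourier f y = (LBINT x. exp (- 2 * of_real pi * \<i> * of_real (x * y)) * f x)"

definition delta_Z :: "real \<Rightarrow> complex" where
  "delta_Z c = (if c \<in> \<int> then 1 else 0)"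

text \<open>
  At \<open>s = 0\<close> the last summand is \<open>0\<close> by the convention \<open>1 / 0 = 0\<close>; this value is immaterial
  whenever \<open>0\<close> is a pole, and is the correct one whenever the coefficient of \<open>1 / s\<close> vanishes.
\<close>

definition Phi :: "nat \<Rightarrow> (real \<Rightarrow> complex) \<Rightarrow> complex \<Rightarrow> real \<Rightarrow> real \<Rightarrow> complex" where
  "Phi k f s a c =
     (LBINT x:{1..}.
        (\<Sum>\<^sub>\<infinity>n\<in>{n::int. of_int n \<noteq> - c}.
           exp (2 * of_real pi * \<i> * of_real (a * (of_int n + c / 2))) * f ((of_int n + c) * x))
        * of_real x powr (s - 1))
   + (-1) ^ k * exp (- of_real pi * \<i> * of_real (a + 1 - c)) *
     (LBINT x:{1..}.
        (\<Sum>\<^sub>\<infinity>m\<in>{m::int. of_int m \<noteq> c - 1}.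
           exp (2 * of_real pi * \<i> * of_real ((1 - a) * (of_int m + (1 - c) / 2)))
           * f ((of_int m + 1 - c) * x))
        * of_real x powr (s - 1))
   - delta_Z c * exp (- of_real pi * \<i> * of_real (a * c)) * (1 + (-1) ^ k) * f 0 * (1 / s)"

definition Fk :: "nat \<Rightarrow> (real \<Rightarrow> complex) \<Rightarrow> complex \<Rightarrow> real \<Rightarrow> real \<Rightarrow> complex" where
  "Fk k f s a c =
     Phi k f s a c
     + (-1) ^ k * exp (- of_real pi * \<i> * of_real a) * Phi k (fourier f) (1 - s) (1 - c) a"

end

theory Submission
  imports Defs "HOL-Probability.Probability"
begin

text \<open>
  The substitution \<open>m = - n - 1\<close> turns the second integral of \<open>\<Phi>\<^sub>k\<close> into the first one with \<open>f\<close>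
  replaced by \<open>t \<mapsto> f (- t)\<close>; the exponential prefactor is exactly what the substitution absorbs.
  The quasi-periodicity relations are then index shifts, and the functional equation is this same
  reflection combined with the inversion formula \<open>\<F> (\<F> f) t = f (- t)\<close>, so no Poisson summation
  is needed. The analytic statement holds because the sums decay faster than any power of \<open>x\<close> on
  \<open>[1, \<infinity>)\<close>, so their Mellin integrals over that range are entire and only the explicit terms in
  \<open>1 / s\<close> and \<open>1 / (1 - s)\<close> can contribute poles.
\<close>

section \<open>Twisted sums and their symmetries\<close>

text \<open>All exponential factors of the statement have modulus 1. Recording only their real
  phase, in units of pi, turns identities between them into congruences modulo 2.\<close>

definition cexp_pi :: "real \<Rightarrow> complex" where
  "cexp_pi t = cis (pi * t)"

lemma exp_eq_cexp_pi:
  "exp (of_real pi * \<i> * of_real t) = cexp_pi t"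
  "exp (- of_real pi * \<i> * of_real t) = cexp_pi (- t)"
  "exp (2 * of_real pi * \<i> * of_real t) = cexp_pi (2 * t)"
  "exp (- 2 * of_real pi * \<i> * of_real t) = cexp_pi (- 2 * t)"
  by (simp_all add: cexp_pi_def cis_conv_exp mult_ac)

lemma cexp_pi_add: "cexp_pi (s + t) = cexp_pi s * cexp_pi t"
  by (simp add: cexp_pi_def cis_mult distrib_left)

lemma cexp_pi_even: "cexp_pi (2 * of_int n) = 1"
  using cis_multiple_2pi[of "of_int n"] by (simp add: cexp_pi_def mult_ac)

lemma cexp_pi_eqI:
  assumes "s - t = 2 * of_int n"
  shows "cexp_pi s = cexp_pi t"
proof -
  have "s = t + 2 * of_int n" using assms by simp
  then show ?thesis by (simp only: cexp_pi_add cexp_pi_even mult_1_right)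
qed

lemma norm_cexp_pi [simp]: "norm (cexp_pi t) = 1"
  by (simp add: cexp_pi_def)

lemma cexp_pi_0 [simp]: "cexp_pi 0 = 1"
  by (simp add: cexp_pi_def)

text \<open>The excluded index is the one with n + c = 0, whose term would be constant in x and
  would destroy the decay of the sum.\<close>

definition twisted_sum :: "(real \<Rightarrow> complex) \<Rightarrow> real \<Rightarrow> real \<Rightarrow> real \<Rightarrow> complex" where
  "twisted_sum g a c x =
     (\<Sum>\<^sub>\<infinity>n\<in>{n::int. of_int n \<noteq> - c}. cexp_pi (2 * (a * (of_int n + c / 2))) * g ((of_int n + c) * x))"

definition mellin_tail :: "(real \<Rightarrow> complex) \<Rightarrow> complex \<Rightarrow> complex" where
  "mellin_tail S s = (LBINT x:{1..}. S x * of_real x powr (s - 1))"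

lemma mellin_tail_cmult: "mellin_tail (\<lambda>x. r * S x) s = r * mellin_tail S s"
  unfolding mellin_tail_def by (simp add: mult.assoc)

text \<open>The map n -> -n-1 matches the two index sets and negates the argument of g. Reindexing
  and pulling out a constant are valid for \<open>infsum\<close> even where the family is not
  summable, since both sides then default to 0; so the identity holds for every g and x.\<close>

lemma twisted_sum_reflect:
  "cexp_pi (- (a + 1 - c)) * twisted_sum g (1 - a) (1 - c) x = twisted_sum (\<lambda>t. g (- t)) a c x"
proof -
  have bij: "bij_betw (\<lambda>n. - n - 1) {n::int. of_int n \<noteq> - c} {m::int. of_int m \<noteq> - (1 - c)}"
    by (rule bij_betwI[where g = "\<lambda>n. - n - 1"]) auto
  have "twisted_sum g (1 - a) (1 - c) x =
     (\<Sum>\<^sub>\<infinity>n\<in>{n::int. of_int n \<noteq> - c}.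
        cexp_pi (2 * ((1 - a) * (of_int (- n - 1) + (1 - c) / 2))) * g ((of_int (- n - 1) + (1 - c)) * x))"
    unfolding twisted_sum_def by (rule infsum_reindex_bij_betw[OF bij, symmetric])
  also have "cexp_pi (- (a + 1 - c)) * \<dots> = twisted_sum (\<lambda>t. g (- t)) a c x"
    unfolding twisted_sum_def infsum_cmult_right'[symmetric]
  proof (rule infsum_cong)
    fix n :: int
    \<comment> \<open>The phases on the two sides differ by exactly -2n - 2.\<close>
    have "cexp_pi (- (a + 1 - c)) * cexp_pi (2 * ((1 - a) * (of_int (- n - 1) + (1 - c) / 2)))
        = cexp_pi (2 * (a * (of_int n + c / 2)))"
      unfolding cexp_pi_add[symmetric]
      by (rule cexp_pi_eqI[where n = "- n - 1"]) (simp add: field_simps)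
    moreover have "(of_int (- n - 1) + (1 - c)) * x = - ((of_int n + c) * x)"
      by (simp add: algebra_simps)
    ultimately show "cexp_pi (- (a + 1 - c)) * (cexp_pi (2 * ((1 - a) * (of_int (- n - 1) + (1 - c) / 2)))
          * g ((of_int (- n - 1) + (1 - c)) * x))
        = cexp_pi (2 * (a * (of_int n + c / 2))) * g (- ((of_int n + c) * x))"
      by (simp only: mult.assoc[symmetric])
  qed
  finally show ?thesis .
qed

lemma twisted_sum_shift_left: "twisted_sum g (a + 1) c x = cexp_pi c * twisted_sum g a c x"
  unfolding twisted_sum_def infsum_cmult_right'[symmetric]
proof (rule infsum_cong)
  fix n :: int
  have "cexp_pi (2 * ((a + 1) * (of_int n + c / 2))) = cexp_pi c * cexp_pi (2 * (a * (of_int n + c / 2)))"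
    unfolding cexp_pi_add[symmetric] by (rule cexp_pi_eqI[where n = n]) (simp add: field_simps)
  then show "cexp_pi (2 * ((a + 1) * (of_int n + c / 2))) * g ((of_int n + c) * x)
      = cexp_pi c * (cexp_pi (2 * (a * (of_int n + c / 2))) * g ((of_int n + c) * x))"
    by simp
qed

lemma twisted_sum_shift_right: "twisted_sum g a (c + 1) x = cexp_pi (- a) * twisted_sum g a c x"
proof -
  have bij: "bij_betw (\<lambda>n. n - 1) {n::int. of_int n \<noteq> - c} {m::int. of_int m \<noteq> - (c + 1)}"
    by (rule bij_betwI[where g = "\<lambda>n. n + 1"]) auto
  have "twisted_sum g a (c + 1) x =
     (\<Sum>\<^sub>\<infinity>n\<in>{n::int. of_int n \<noteq> - c}.
        cexp_pi (2 * (a * (of_int (n - 1) + (c + 1) / 2))) * g ((of_int (n - 1) + (c + 1)) * x))"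
    unfolding twisted_sum_def by (rule infsum_reindex_bij_betw[OF bij, symmetric])
  also have "\<dots> = cexp_pi (- a) * twisted_sum g a c x"
    unfolding twisted_sum_def infsum_cmult_right'[symmetric]
  proof (rule infsum_cong)
    fix n :: int
    have "cexp_pi (2 * (a * (of_int (n - 1) + (c + 1) / 2)))
        = cexp_pi (- a) * cexp_pi (2 * (a * (of_int n + c / 2)))"
      unfolding cexp_pi_add[symmetric] by (rule cexp_pi_eqI[where n = 0]) (simp add: field_simps)
    moreover have "(of_int (n - 1) + (c + 1)) * x = (of_int n + c) * x"
      by simp
    ultimately show "cexp_pi (2 * (a * (of_int (n - 1) + (c + 1) / 2))) * g ((of_int (n - 1) + (c + 1)) * x)
        = cexp_pi (- a) * (cexp_pi (2 * (a * (of_int n + c / 2))) * g ((of_int n + c) * x))"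
      by (simp only: mult.assoc)
  qed
  finally show ?thesis .
qed

section \<open>Transformation laws of Phi_k and F_k\<close>

text \<open>Reflection absorbs the prefactor of the second integral, so both integrals carry the
  same parameters a and c, and each symmetry of \<open>twisted_sum\<close> transfers to both at
  once.\<close>

lemma Phi_eq:
  "Phi k f s a c =
     mellin_tail (twisted_sum f a c) s + (-1) ^ k * mellin_tail (twisted_sum (\<lambda>t. f (- t)) a c) s
     - delta_Z c * cexp_pi (- (a * c)) * (1 + (-1) ^ k) * f 0 * (1 / s)"
proof -
  have 1: "(\<lambda>x. cexp_pi (- (a + 1 - c)) *
      (\<Sum>\<^sub>\<infinity>m\<in>{m::int. of_int m \<noteq> c - 1}. cexp_pi (2 * ((1 - a) * (of_int m + (1 - c) / 2)))
           * f ((of_int m + 1 - c) * x))) = twisted_sum (\<lambda>t. f (- t)) a c"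
    by (rule ext, subst twisted_sum_reflect[symmetric]) (simp add: twisted_sum_def add_diff_eq)
  show ?thesis
    unfolding 1[symmetric] mellin_tail_cmult Phi_def exp_eq_cexp_pi
    unfolding mellin_tail_def twisted_sum_def by (simp only: mult.assoc)
qed

lemma delta_Z_shift [simp]: "delta_Z (c + 1) = delta_Z c"
  unfolding delta_Z_def
  by (metis Ints_1 Ints_add Ints_diff add_diff_cancel_right')

lemma Phi_shift_left: "Phi k f s (a + 1) c = cexp_pi c * Phi k f s a c"
proof -
  \<comment> \<open>The phases differ by -2c, an even integer whenever \<open>delta_Z c\<close> is
    nonzero.\<close>
  have delta: "delta_Z c * cexp_pi (- ((a + 1) * c)) = cexp_pi c * (delta_Z c * cexp_pi (- (a * c)))"
  proof (cases "c \<in> \<int>")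
    case True
    then obtain m where m: "c = of_int m" by (auto elim: Ints_cases)
    have "cexp_pi (- ((a + 1) * c)) = cexp_pi c * cexp_pi (- (a * c))"
      unfolding cexp_pi_add[symmetric] by (rule cexp_pi_eqI[where n = "- m"]) (simp add: m field_simps)
    then show ?thesis by simp
  qed (simp add: delta_Z_def)
  show ?thesis
    unfolding Phi_eq twisted_sum_shift_left[abs_def] mellin_tail_cmult delta by (simp add: algebra_simps)
qed

lemma Phi_shift_right: "Phi k f s a (c + 1) = cexp_pi (- a) * Phi k f s a c"
proof -
  have "cexp_pi (- (a * (c + 1))) = cexp_pi (- a) * cexp_pi (- (a * c))"
    by (simp add: cexp_pi_add[symmetric] algebra_simps)
  then show ?thesis
    unfolding Phi_eq twisted_sum_shift_right[abs_def] mellin_tail_cmult delta_Z_shift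
    by (simp add: algebra_simps)
qed

text \<open>Reflecting the function undoes the reflection caused by passing from (a, c) to (1-a,
  1-c), so each of the two integrals returns to itself. This is what applying the duality of F_k
  twice amounts to.\<close>

lemma Phi_reflect: "cexp_pi (- (a + 1 - c)) * Phi k (\<lambda>t. f (- t)) s (1 - a) (1 - c) = Phi k f s a c"
proof -
  have 1: "cexp_pi (- (a + 1 - c)) * mellin_tail (twisted_sum g (1 - a) (1 - c)) s
      = mellin_tail (twisted_sum (\<lambda>t. g (- t)) a c) s" for g
    unfolding mellin_tail_cmult[symmetric] twisted_sum_reflect ..
  \<comment> \<open>In the term in 1/s the phases differ by 2c - 2, which is even when c is an
    integer; otherwise both deltas vanish.\<close>
  have "cexp_pi (- (a + 1 - c)) * (delta_Z (1 - c) * cexp_pi (- ((1 - a) * (1 - c))))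
      = delta_Z c * cexp_pi (- (a * c))"
  proof (cases "c \<in> \<int>")
    case True
    then obtain m where m: "c = of_int m" by (auto elim: Ints_cases)
    have "cexp_pi (- (a + 1 - c)) * cexp_pi (- ((1 - a) * (1 - c))) = cexp_pi (- (a * c))"
      unfolding cexp_pi_add[symmetric] by (rule cexp_pi_eqI[where n = "m - 1"]) (simp add: m field_simps)
    with True show ?thesis by (simp add: delta_Z_def)
  next
    case False
    have "1 - c \<notin> \<int>"
    proof
      assume "1 - c \<in> \<int>"
      then have "1 - (1 - c) \<in> \<int>" by (intro Ints_diff) auto
      with False show False by simp
    qed
    with False show ?thesis by (simp add: delta_Z_def)
  qed
  note 2 = this
  have "cexp_pi (- (a + 1 - c)) * Phi k (\<lambda>t. f (- t)) s (1 - a) (1 - c) =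
      cexp_pi (- (a + 1 - c)) * mellin_tail (twisted_sum (\<lambda>t. f (- t)) (1 - a) (1 - c)) s
      + (-1) ^ k * (cexp_pi (- (a + 1 - c)) * mellin_tail (twisted_sum f (1 - a) (1 - c)) s)
      - (cexp_pi (- (a + 1 - c)) * (delta_Z (1 - c) * cexp_pi (- ((1 - a) * (1 - c)))))
         * (1 + (-1) ^ k) * f 0 * (1 / s)"
    unfolding Phi_eq by (simp add: ring_distribs mult.left_commute mult.assoc)
  also have "\<dots> = Phi k f s a c"
    unfolding 1 2 by (simp add: Phi_eq)
  finally show ?thesis .
qed

lemma Fk_eq: "Fk k f s a c = Phi k f s a c + (-1) ^ k * cexp_pi (- a) * Phi k (fourier f) (1 - s) (1 - c) a"
  by (simp only: Fk_def exp_eq_cexp_pi)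

lemma Fk_shift_left: "Fk k f s (a + 1) c = cexp_pi c * Fk k f s a c"
proof -
  have "cexp_pi (- (a + 1)) * cexp_pi (- (1 - c)) = cexp_pi c * cexp_pi (- a)"
    unfolding cexp_pi_add[symmetric] by (rule cexp_pi_eqI[where n = "- 1"]) simp
  then have *: "cexp_pi (- (a + 1)) * (cexp_pi (- (1 - c)) * z) = cexp_pi c * (cexp_pi (- a) * z)" for z
    by (simp only: mult.assoc[symmetric])
  show ?thesis
    unfolding Fk_eq Phi_shift_left Phi_shift_right mult.assoc * by (simp add: algebra_simps)
qed

lemma Fk_shift_right: "Fk k f s a (c + 1) = cexp_pi (- a) * Fk k f s a c"
proof -
  \<comment> \<open>Raising c by 1 turns the dual parameter 1 - c into -c, so the left shift is
    applied at -c and then inverted.\<close>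
  have "cexp_pi a * Phi k (fourier f) (1 - s) (- c) a = Phi k (fourier f) (1 - s) (1 - c) a"
    using Phi_shift_left[of k "fourier f" "1 - s" "- c" a] by (simp add: add.commute)
  then have "cexp_pi (- a) * Phi k (fourier f) (1 - s) (1 - c) a = Phi k (fourier f) (1 - s) (- c) a"
    by (simp add: mult.assoc[symmetric] cexp_pi_add[symmetric] flip: \<open>_ = Phi k (fourier f) (1 - s) (1 - c) a\<close>)
  then show ?thesis
    unfolding Fk_eq Phi_shift_right by (simp add: ring_distribs mult_ac)
qed

text \<open>The two summands of F_k trade places. The dual of the dual is \<open>Phi\<close> of the
  reflected function at (s, 1-a, 1-c), which \<open>Phi_reflect\<close> identifies with the original
  first summand, and the two signs (-1)^k cancel.\<close>

lemma Fk_functional_equation: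
  assumes "fourier (fourier f) = (\<lambda>t. f (- t))"
  shows "Fk k f s a c = (-1) ^ k * cexp_pi (- a) * Fk k (fourier f) (1 - s) (1 - c) a"
proof -
  have "cexp_pi (- a) * cexp_pi (- (1 - c)) = cexp_pi (- (a + 1 - c))"
    by (simp add: cexp_pi_add[symmetric] algebra_simps)
  then have *: "cexp_pi (- a) * (cexp_pi (- (1 - c)) * Phi k (\<lambda>t. f (- t)) s (1 - a) (1 - c)) = Phi k f s a c"
    by (simp only: mult.assoc[symmetric] Phi_reflect)
  have "(-1) ^ k * cexp_pi (- a) * Fk k (fourier f) (1 - s) (1 - c) a
      = (-1) ^ k * cexp_pi (- a) * Phi k (fourier f) (1 - s) (1 - c) a
        + ((-1) ^ k * (-1) ^ k) * (cexp_pi (- a) * (cexp_pi (- (1 - c)) * Phi k (\<lambda>t. f (- t)) s (1 - a) (1 - c)))"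
    unfolding Fk_eq assms by (simp add: algebra_simps)
  also have "\<dots> = Fk k f s a c"
    unfolding * by (simp add: Fk_eq flip: power_mult_distrib)
  finally show ?thesis ..
qed

section \<open>Mellin integrals of rapidly decreasing functions\<close>

text \<open>Nothing is asked of derivatives, so the condition can be verified for
  \<open>fourier f\<close> without studying the smoothness of the transform.\<close>

definition rapidly_decreasing :: "(real \<Rightarrow> complex) \<Rightarrow> bool" where
  "rapidly_decreasing g \<longleftrightarrow>
     g \<in> borel_measurable borel \<and> (\<forall>m. \<exists>C. \<forall>x. \<bar>x\<bar> ^ m * norm (g x) \<le> C)"

lemma rapidly_decreasing_reflect:
  assumes "rapidly_decreasing g"
  shows "rapidly_decreasing (\<lambda>x. g (- x))"
  unfolding rapidly_decreasing_def
proof (intro conjI allI)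
  have [measurable]: "g \<in> borel_measurable borel" using assms by (simp add: rapidly_decreasing_def)
  show "(\<lambda>x. g (- x)) \<in> borel_measurable borel" by measurable
  fix m
  obtain C where "\<And>x. \<bar>x\<bar> ^ m * norm (g x) \<le> C"
    using assms unfolding rapidly_decreasing_def by blast
  then have "\<bar>x\<bar> ^ m * norm (g (- x)) \<le> C" for x
    by (metis abs_minus_cancel)
  then show "\<exists>C. \<forall>x. \<bar>x\<bar> ^ m * norm (g (- x)) \<le> C" by blast
qed

section \<open>Convergence, measurability and decay of twisted sums\<close>

lemma summable_on_inverse_square_shift:
  fixes c :: real
  shows "(\<lambda>n::int. 1 / (of_int n + c)\<^sup>2) summable_on A"
proof (rule summable_on_subset_banach)
  let ?u = "\<lambda>n::int. 1 / (of_int n + c)\<^sup>2"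
  have S: "(\<lambda>k::nat. 1 / (1 + real k)\<^sup>2) summable_on UNIV"
  proof (rule norm_summable_imp_summable_on)
    have "summable (\<lambda>n. 1 / (real (Suc n))\<^sup>2)"
      unfolding summable_Suc_iff[of "\<lambda>n. 1 / (real n)\<^sup>2"]
      using inverse_power_summable[of 2, where 'a = real] by (simp add: divide_inverse)
    then show "summable (\<lambda>n. norm (1 / (1 + real n)\<^sup>2))" by simp
  qed
  \<comment> \<open>The progressions \<open>p\<close> and \<open>q\<close> run away from -c on
    either side, with |n + c| at least 1 + k at step k. They omit the two integers where n + c is
    \<open>frac c\<close> or \<open>frac c - 1\<close>: the distance there can be less than 1, and a
    zero denominator gives the value 0.\<close>
  define p where "p k = 1 - \<lfloor>c\<rfloor> + int k" for k
  define q where "q k = - 2 - \<lfloor>c\<rfloor> - int k" for k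
  have fl: "of_int \<lfloor>c\<rfloor> \<le> c" "c < of_int \<lfloor>c\<rfloor> + 1" by linarith+
  have P: "?u summable_on range p"
  proof (subst summable_on_reindex)
    show "inj p" by (auto simp: p_def inj_def)
    show "(?u \<circ> p) summable_on UNIV"
    proof (rule summable_on_comparison_test[OF S])
      fix k
      have "(1 + real k)\<^sup>2 \<le> (of_int (p k) + c)\<^sup>2"
        by (rule power_mono) (use fl in \<open>auto simp: p_def\<close>)
      then show "(?u \<circ> p) k \<le> 1 / (1 + real k)\<^sup>2"
        unfolding o_def by (intro divide_left_mono mult_pos_pos) (auto intro: less_le_trans[rotated])
    qed auto
  qed
  have Q: "?u summable_on range q"
  proof (subst summable_on_reindex)
    show "inj q" by (auto simp: q_def inj_def)
    show "(?u \<circ> q) summable_on UNIV"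
    proof (rule summable_on_comparison_test[OF S])
      fix k
      have "(1 + real k)\<^sup>2 \<le> (- (of_int (q k) + c))\<^sup>2"
        by (rule power_mono) (simp_all add: q_def, linarith)
      then have "(1 + real k)\<^sup>2 \<le> (of_int (q k) + c)\<^sup>2" by (simp only: power2_minus)
      then show "(?u \<circ> q) k \<le> 1 / (1 + real k)\<^sup>2"
        unfolding o_def by (intro divide_left_mono mult_pos_pos) (auto intro: less_le_trans[rotated])
    qed auto
  qed
  have "n \<in> range p \<union> (range q \<union> {- \<lfloor>c\<rfloor>, - 1 - \<lfloor>c\<rfloor>})" for n
  proof -
    consider "n \<ge> 1 - \<lfloor>c\<rfloor>" | "n \<le> - 2 - \<lfloor>c\<rfloor>" | "n = - \<lfloor>c\<rfloor>" | "n = - 1 - \<lfloor>c\<rfloor>" by linarith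
    then show ?thesis
    proof cases
      case 1
      then have "n = p (nat (n - (1 - \<lfloor>c\<rfloor>)))" by (simp add: p_def)
      then show ?thesis by blast
    next
      case 2
      then have "n = q (nat (- 2 - \<lfloor>c\<rfloor> - n))" by (simp add: q_def)
      then show ?thesis by blast
    qed auto
  qed
  then have U: "UNIV = range p \<union> (range q \<union> {- \<lfloor>c\<rfloor>, - 1 - \<lfloor>c\<rfloor>})" by blast
  show "?u summable_on UNIV"
    unfolding U by (intro summable_on_union P Q) simp
qed auto

text \<open>Along an enumeration of the index set, the sum is a pointwise limit of measurable finite
  sums wherever it converges absolutely; the indicator discards all other points.\<close>

lemma twisted_sum_measurable:
  assumes [measurable]: "g \<in> borel_measurable borel"
    and summable: "\<And>x. x \<in> X \<Longrightarrow>
      (\<lambda>n. norm (cexp_pi (2 * (a * (of_int n + c / 2))) * g ((of_int n + c) * x))) summable_on {n::int. of_int n \<noteq> - c}"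
    and [measurable]: "X \<in> sets borel"
  shows "(\<lambda>x. indicator X x *\<^sub>R twisted_sum g a c x) \<in> borel_measurable borel"
proof -
  let ?A = "{n::int. of_int n \<noteq> - c}"
  let ?t = "\<lambda>n x. cexp_pi (2 * (a * (of_int n + c / 2))) * g ((of_int n + c) * x)"
  define r where "r = (from_nat_into ?A)"
  have inf: "infinite ?A"
  proof
    assume "finite ?A"
    \<comment> \<open>At most one integer is missing from the index set, and if so it is minus the
      floor of c.\<close>
    moreover have "UNIV \<subseteq> insert (- \<lfloor>c\<rfloor>) ?A"
    proof
      fix n :: int
      show "n \<in> insert (- \<lfloor>c\<rfloor>) ?A"
      proof (cases "of_int n = - c")
        case True
        then have "c = of_int (- n)" by simp
        then show ?thesis by simp
      qed simp
    qed
    ultimately have "finite (UNIV :: int set)" by (meson finite_insert finite_subset)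
    then show False by simp
  qed
  have bij: "bij_betw r UNIV ?A"
    unfolding r_def by (rule bij_betw_from_nat_into) (use inf in auto)
  have "(\<lambda>N. indicator X x *\<^sub>R (\<Sum>j<N. ?t (r j) x)) \<longlonglongrightarrow> indicator X x *\<^sub>R twisted_sum g a c x" for x
  proof (cases "x \<in> X")
    case True
    have "((\<lambda>n. ?t n x) has_sum twisted_sum g a c x) ?A"
      unfolding twisted_sum_def using summable[OF True] by (simp add: abs_summable_summable)
    then have "((\<lambda>j. ?t (r j) x) has_sum twisted_sum g a c x) UNIV"
      using has_sum_reindex_bij_betw[OF bij, of "\<lambda>n. ?t n x"] by simp
    then have "(\<lambda>j. ?t (r j) x) sums twisted_sum g a c x" by (rule has_sum_imp_sums)
    then show ?thesis unfolding sums_def by (intro tendsto_intros)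
  qed simp
  then show ?thesis
    by (rule borel_measurable_LIMSEQ_metric[rotated]) measurable
qed

text \<open>The numbers |n + c| have a positive lower bound d on the index set. In the bound on |(n
  + c) x|^(m+2) |g((n + c) x)|, m powers of |n + c| are traded for d^m, which leaves x^m for the
  decay and (n + c)^2 for the convergence of the sum.\<close>

lemma twisted_sum_decay:
  assumes g: "rapidly_decreasing g"
  shows "(\<lambda>x. indicator {1..} x *\<^sub>R twisted_sum g a c x) \<in> borel_measurable borel"
    and "\<exists>C. \<forall>x\<ge>1. x ^ m * norm (twisted_sum g a c x) \<le> C"
proof -
  let ?A = "{n::int. of_int n \<noteq> - c}"
  let ?t = "\<lambda>x n. cexp_pi (2 * (a * (of_int n + c / 2))) * g ((of_int n + c) * x)"
  have meas [measurable]: "g \<in> borel_measurable borel" using g by (simp add: rapidly_decreasing_def)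
  have ex: "\<exists>d. 0 < d \<and> (\<forall>n\<in>?A. d \<le> \<bar>of_int n + c\<bar>)"
  proof -
    \<comment> \<open>If \<open>frac c\<close> is 0, the index with n + c = 0 is excluded; replacing
      0 by 1 keeps the minimum positive.\<close>
    let ?d = "\<lambda>z. if z = 0 then 1 else \<bar>z\<bar>"
    let ?F = "{1, ?d (frac c), 1 - frac c}"
    let ?m = "Min ?F"
    have lt: "frac c < 1" "0 \<le> frac c" by (auto simp: frac_lt_1)
    have "0 < ?m" using lt by (subst Min_gr_iff) auto
    moreover have "?m \<le> \<bar>of_int n + c\<bar>" if n: "n \<in> ?A" for n
    proof -
      define k where "k = n + \<lfloor>c\<rfloor>"
      have eq: "of_int n + c = of_int k + frac c" by (simp add: k_def frac_def)
      have m: "?m \<le> 1" "?m \<le> ?d (frac c)" "?m \<le> 1 - frac c" by (rule Min_le; simp)+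
      consider "k = 0" | "k \<ge> 1" | "k \<le> - 1" by linarith
      then show ?thesis
      proof cases
        case 1
        then have "frac c = of_int n + c" using eq by simp
        moreover have "of_int n + c \<noteq> 0" using n by (simp add: eq_neg_iff_add_eq_0)
        ultimately have "frac c \<noteq> 0" by simp
        with 1 m(2) show ?thesis unfolding eq by (simp del: Min_le_iff)
      next
        case 2
        then have "1 \<le> real_of_int k" by simp
        then have "1 \<le> \<bar>of_int k + frac c\<bar>" using lt by linarith
        with m(1) show ?thesis unfolding eq by (rule order_trans)
      next
        case 3
        then have "real_of_int k \<le> - 1" by simp
        then have "1 - frac c \<le> \<bar>of_int k + frac c\<bar>" using lt by linarith
        with m(3) show ?thesis unfolding eq by (rule order_trans)
      qed
    qed
    ultimately show ?thesis by blast
  qed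
  have bound: "\<exists>C\<ge>0. \<forall>x\<ge>1. \<forall>n\<in>?A. x ^ m * norm (?t x n) \<le> C * (1 / (of_int n + c)\<^sup>2)" for m
  proof -
    obtain d where d: "0 < d" "\<And>n. n \<in> ?A \<Longrightarrow> d \<le> \<bar>of_int n + c\<bar>" using ex by blast
    obtain C where C: "\<And>x. \<bar>x\<bar> ^ (m + 2) * norm (g x) \<le> C"
      using g unfolding rapidly_decreasing_def by blast
    have "0 \<le> C" using C[of 0] by simp
    have "x ^ m * norm (?t x n) \<le> (C / d ^ m) * (1 / (of_int n + c)\<^sup>2)" if x: "x \<ge> 1" and n: "n \<in> ?A" for x n
    proof -
      let ?y = "\<bar>of_int n + c\<bar>"
      have y: "d \<le> ?y" "0 < ?y" using d(2)[OF n] d(1) by auto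
      \<comment> \<open>Besides d <= |n + c|, this uses x^2 >= 1 to complete the power
        x^(m+2).\<close>
      have "d ^ m * x ^ m * ?y\<^sup>2 * norm (g ((of_int n + c) * x)) \<le> ?y ^ m * (x ^ m * x\<^sup>2) * ?y\<^sup>2 * norm (g ((of_int n + c) * x))"
      proof (intro mult_right_mono mult_mono power_mono)
        have "1 \<le> x\<^sup>2" using x by simp
        then show "x ^ m \<le> x ^ m * x\<^sup>2" using x by (simp add: mult_le_cancel_left1)
      qed (use x y d in auto)
      also have "\<dots> = \<bar>(of_int n + c) * x\<bar> ^ (m + 2) * norm (g ((of_int n + c) * x))"
        using x by (simp only: abs_mult power_add power_mult_distrib mult_ac abs_of_nonneg[of x])
      also have "\<dots> \<le> C" by (rule C)
      finally have "d ^ m * x ^ m * ?y\<^sup>2 * norm (g ((of_int n + c) * x)) \<le> C" .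
      then have "x ^ m * norm (g ((of_int n + c) * x)) \<le> C / (d ^ m * ?y\<^sup>2)"
        using d(1) y(2) by (subst pos_le_divide_eq) (auto simp: mult_ac)
      then show ?thesis by (simp add: norm_mult)
    qed
    then show ?thesis using \<open>0 \<le> C\<close> d(1) by (intro exI[of _ "C / d ^ m"]) auto
  qed
  have sq: "(\<lambda>n::int. C * (1 / (of_int n + c)\<^sup>2)) summable_on ?A" for C
    by (intro summable_on_cmult_right summable_on_inverse_square_shift)
  have summ: "(\<lambda>n. norm (?t x n)) summable_on ?A" if x: "x \<ge> 1" for x
  proof -
    obtain C where C: "\<forall>x\<ge>1. \<forall>n\<in>?A. x ^ 0 * norm (?t x n) \<le> C * (1 / (of_int n + c)\<^sup>2)" using bound[of 0] by blast
    show ?thesis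
      by (rule summable_on_comparison_test[OF sq[of C]]) (use C x in auto)
  qed
  show "(\<lambda>x. indicator {1..} x *\<^sub>R twisted_sum g a c x) \<in> borel_measurable borel"
    by (rule twisted_sum_measurable) (use summ in auto)
  obtain C where C: "\<forall>x\<ge>1. \<forall>n\<in>?A. x ^ m * norm (?t x n) \<le> C * (1 / (of_int n + c)\<^sup>2)" using bound[of m] by blast
  have "x ^ m * norm (twisted_sum g a c x) \<le> (\<Sum>\<^sub>\<infinity>n\<in>?A. C * (1 / (of_int n + c)\<^sup>2))" if x: "x \<ge> 1" for x
  proof -
    have "x ^ m * norm (twisted_sum g a c x) \<le> x ^ m * (\<Sum>\<^sub>\<infinity>n\<in>?A. norm (?t x n))"
      unfolding twisted_sum_def using x by (intro mult_left_mono norm_infsum_bound summ) auto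
    also have "\<dots> = (\<Sum>\<^sub>\<infinity>n\<in>?A. x ^ m * norm (?t x n))"
      by (rule infsum_cmult_right'[symmetric])
    also have "\<dots> \<le> (\<Sum>\<^sub>\<infinity>n\<in>?A. C * (1 / (of_int n + c)\<^sup>2))"
      by (rule infsum_mono) (use C x sq summ[OF x] in \<open>auto intro: summable_on_cmult_right\<close>)
    finally show ?thesis .
  qed
  then show "\<exists>C. \<forall>x\<ge>1. x ^ m * norm (twisted_sum g a c x) \<le> C" by blast
qed

section \<open>Holomorphy of Mellin integrals over [1, infinity)\<close>

lemma powr_of_real_ge_1:
  assumes "x \<ge> (1::real)"
  shows "of_real x powr w = exp (w * complex_of_real (ln x))"
  using assms by (simp add: powr_def Ln_of_real)

lemma norm_powr_le_power:
  assumes x: "x \<ge> (1::real)" and w: "Re w \<le> real N"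
  shows "norm (of_real x powr w :: complex) \<le> x ^ N"
proof -
  have "norm (of_real x powr w :: complex) = exp (Re w * ln x)"
    using x by (simp add: powr_of_real_ge_1)
  also have "\<dots> \<le> exp (real N * ln x)"
    using x w by (simp add: mult_right_mono)
  also have "\<dots> = x ^ N"
    using x by (simp add: exp_of_nat_mult)
  finally show ?thesis .
qed

lemma integrable_inverse_square_tail: "integrable lborel (\<lambda>x::real. indicator {1..} x * (C / x\<^sup>2))"
proof (rule Bochner_Integration.integrable_bound)
  have "integrable lborel (\<lambda>x::real. inverse (1 + x\<^sup>2))"
    using integrable_inverse_1_plus_square by (simp add: set_integrable_def)
  then show "integrable lborel (\<lambda>x::real. 2 * \<bar>C\<bar> * inverse (1 + x\<^sup>2))" by simp
  have "\<bar>C\<bar> / x\<^sup>2 \<le> 2 * \<bar>C\<bar> / (1 + x\<^sup>2)" if "x \<ge> 1" for x :: real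
  proof -
    have "1 \<le> x\<^sup>2" using that by simp
    then have "\<bar>C\<bar> * (1 + x\<^sup>2) \<le> \<bar>C\<bar> * (2 * x\<^sup>2)" by (intro mult_left_mono) auto
    moreover have "0 < x\<^sup>2" "0 < 1 + x\<^sup>2" using \<open>1 \<le> x\<^sup>2\<close> by linarith+
    ultimately show ?thesis by (simp add: divide_simps mult_ac)
  qed
  then show "AE x in lborel. norm (indicator {1..} x * (C / x\<^sup>2)) \<le> norm (2 * \<bar>C\<bar> * inverse (1 + x\<^sup>2))"
    by (auto simp: indicator_def divide_inverse abs_mult)
qed measurable

text \<open>Differentiation under the integral sign: for |h| <= 1 the difference quotients of the
  integrand are dominated by |T s x| x^2, which is integrable because S decays faster than every
  power.\<close>

lemma mellin_tail_holomorphic: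
  assumes meas: "(\<lambda>x. indicator {1..} x *\<^sub>R S x) \<in> borel_measurable borel"
    and decay: "\<And>m. \<exists>C. \<forall>x\<ge>1. x ^ m * norm (S x) \<le> C"
  shows "mellin_tail S holomorphic_on UNIV"
proof -
  define U where "U = (\<lambda>x. indicator {1..} x *\<^sub>R S x)"
  define T where "T s x = U x * of_real x powr (s - 1)" for s x
  have U_meas [measurable]: "U \<in> borel_measurable borel" using meas by (simp add: U_def)
  have U_0: "U x = 0" if "x < 1" for x using that by (simp add: U_def)
  have T_meas [measurable]: "T s \<in> borel_measurable borel" for s
    unfolding T_def by measurable
  have T_bound: "\<exists>C. \<forall>x. norm (T s x) * x ^ 2 \<le> indicator {1..} x * (C / x\<^sup>2)" for s
  proof -
    define N where "N = nat \<lceil>Re s - 1\<rceil>"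
    have N: "Re (s - 1) \<le> real N" by (simp add: N_def) linarith
    \<comment> \<open>Of the exponent N + 4, N offsets the power x^(s-1), two pay for the factor x^2
      and two leave the integrable bound C/x^2.\<close>
    obtain C where C: "\<forall>x\<ge>1. x ^ (N + 4) * norm (S x) \<le> C" using decay[of "N + 4"] by blast
    have "norm (T s x) * x ^ 2 \<le> C / x\<^sup>2" if x: "x \<ge> 1" for x
    proof -
      have "norm (T s x) * x ^ 2 \<le> (norm (S x) * x ^ N) * x ^ 2"
        unfolding T_def U_def norm_mult using x norm_powr_le_power[OF x N]
        by (intro mult_right_mono mult_mono) auto
      also have "\<dots> = (x ^ (N + 4) * norm (S x)) / x\<^sup>2"
        using x by (simp add: power_add field_simps power2_eq_square power4_eq_xxxx)
      also have "\<dots> \<le> C / x\<^sup>2" using C x by (intro divide_right_mono) auto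
      finally show ?thesis .
    qed
    then have "norm (T s x) * x ^ 2 \<le> indicator {1..} x * (C / x\<^sup>2)" for x
      by (cases "x \<ge> 1") (auto simp: T_def U_0)
    then show ?thesis by blast
  qed
  have T_1: "norm (T s x) \<le> norm (T s x) * x ^ 2" for s x
  proof (cases "x \<ge> 1")
    case True
    then have "1 \<le> x ^ 2" by simp
    then show ?thesis by (simp add: mult_le_cancel_left1)
  qed (simp add: T_def U_0)
  have T_int: "integrable lborel (T s)" for s
  proof -
    obtain C where C: "\<And>x. norm (T s x) * x ^ 2 \<le> indicator {1..} x * (C / x\<^sup>2)" using T_bound by blast
    have *: "norm (T s x) \<le> norm (indicator {1..} x * (C / x\<^sup>2))" for x
      using order_trans[OF order_trans[OF T_1 C[of x]] abs_ge_self] by (simp only: real_norm_def)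
    show ?thesis
      by (rule Bochner_Integration.integrable_bound[OF integrable_inverse_square_tail[of C]])
        (use * in auto)
  qed
  have mellin: "mellin_tail S s = (LBINT x. T s x)" for s
    by (simp add: mellin_tail_def set_lebesgue_integral_def T_def U_def)
  have "(mellin_tail S has_field_derivative (LBINT x. T s x * of_real (ln x))) (at s)" for s
    unfolding DERIV_def
  proof -
    \<comment> \<open>Restricting to the unit ball gives |h| <= 1 along the entire sequence, so a
      single dominating function serves all its terms.\<close>
    have "((\<lambda>h. (mellin_tail S (s + h) - mellin_tail S s) / h) \<longlongrightarrow> (LBINT x. T s x * of_real (ln x)))
        (at 0 within ball 0 1)"
      unfolding tendsto_at_iff_sequentially
    proof (intro allI impI)
      fix h :: "nat \<Rightarrow> complex"
      assume h: "\<forall>i. h i \<in> ball 0 1 - {0}" and lim: "h \<longlonglongrightarrow> 0"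
      have h0: "h i \<noteq> 0" and h1: "norm (h i) \<le> 1" for i using h[rule_format, of i] by auto
      have quot: "(mellin_tail S (s + h i) - mellin_tail S s) / h i = (LBINT x. (T (s + h i) x - T s x) / h i)" for i
        by (simp add: mellin T_int)
      have TT: "T (s + h i) x - T s x = T s x * (exp (h i * of_real (ln x)) - 1)" for i x
      proof (cases "x \<ge> 1")
        case True
        then show ?thesis
          by (simp add: T_def powr_of_real_ge_1 algebra_simps flip: exp_add)
      qed (simp add: T_def U_0)
      obtain C where C: "\<And>x. norm (T s x) * x ^ 2 \<le> indicator {1..} x * (C / x\<^sup>2)" using T_bound by blast
      have "(\<lambda>i. LBINT x. (T (s + h i) x - T s x) / h i) \<longlonglongrightarrow> (LBINT x. T s x * of_real (ln x))"
      proof (rule integral_dominated_convergence[where w = "\<lambda>x. indicator {1..} x * (C / x\<^sup>2)"])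
        show "AE x in lborel. (\<lambda>i. (T (s + h i) x - T s x) / h i) \<longlonglongrightarrow> T s x * of_real (ln x)"
        proof (rule AE_I2)
          fix x :: real
          have "((\<lambda>z. exp (z * of_real (ln x))) has_field_derivative of_real (ln x)) (at (0::complex))"
            by (auto intro!: derivative_eq_intros)
          then have "((\<lambda>z. (exp (z * of_real (ln x)) - 1) / z) \<longlongrightarrow> of_real (ln x)) (at (0::complex))"
            by (simp add: DERIV_def)
          moreover have "filterlim h (at 0) sequentially"
            using lim h0 by (simp add: filterlim_at)
          ultimately have "(\<lambda>i. (exp (h i * of_real (ln x)) - 1) / h i) \<longlonglongrightarrow> of_real (ln x)"
            by (rule filterlim_compose)
          then have "(\<lambda>i. T s x * ((exp (h i * of_real (ln x)) - 1) / h i)) \<longlonglongrightarrow> T s x * of_real (ln x)"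
            by (rule tendsto_mult_left)
          then show "(\<lambda>i. (T (s + h i) x - T s x) / h i) \<longlonglongrightarrow> T s x * of_real (ln x)"
            by (simp add: TT)
        qed
        fix i
        show "AE x in lborel. norm ((T (s + h i) x - T s x) / h i) \<le> indicator {1..} x * (C / x\<^sup>2)"
        proof (rule AE_I2)
          fix x :: real
          show "norm ((T (s + h i) x - T s x) / h i) \<le> indicator {1..} x * (C / x\<^sup>2)"
          proof (cases "x \<ge> 1")
            case True
            let ?z = "h i * of_real (ln x)"
            have ln: "0 \<le> ln x" "ln x \<le> x" using True ln_bound[of x] by auto
            have z: "norm ?z = norm (h i) * ln x" using ln by (simp add: norm_mult)
            \<comment> \<open>This is the Taylor remainder of order 0. Since |h| <= 1 and 0 <= ln x
              <= x, the factor exp |z| costs at most x, and |z| / |h| = ln x costs at most another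
              x.\<close>
            have "norm (exp ?z - 1) \<le> exp (norm ?z) * norm ?z"
              using Taylor_exp_field[of ?z 0] by simp
            also have "\<dots> \<le> x * (norm (h i) * x)"
            proof (rule mult_mono)
              have "norm ?z \<le> ln x"
                unfolding z using ln h1[of i] by (simp add: mult_left_le_one_le)
              then have "exp (norm ?z) \<le> exp (ln x)" by simp
              then show "exp (norm ?z) \<le> x" using True by simp
              show "norm ?z \<le> norm (h i) * x" unfolding z using ln by (intro mult_left_mono) auto
            qed (use True in auto)
            finally have "norm (exp ?z - 1) / norm (h i) \<le> x ^ 2"
              using h0[of i] by (simp add: divide_simps power2_eq_square mult_ac)
            then have "norm (T s x) * (norm (exp ?z - 1) / norm (h i)) \<le> norm (T s x) * x ^ 2"
              by (rule mult_left_mono) simp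
            with C[of x] show ?thesis
              by (simp add: TT norm_mult norm_divide)
          qed (simp add: T_def U_0)
        qed
      qed (use integrable_inverse_square_tail[of C] in auto)
      then show "((\<lambda>h. (mellin_tail S (s + h) - mellin_tail S s) / h) \<circ> h) \<longlonglongrightarrow> (LBINT x. T s x * of_real (ln x))"
        by (simp add: o_def quot)
    qed
    then show "(\<lambda>h. (mellin_tail S (s + h) - mellin_tail S s) / h) \<midarrow>0\<rightarrow> (LBINT x. T s x * of_real (ln x))"
      by (simp add: at_within_open[of 0 "ball 0 1"])
  qed
  then show ?thesis
    by (auto simp: holomorphic_on_def field_differentiable_def)
qed

lemma mellin_tail_twisted_sum_holomorphic:
  assumes "rapidly_decreasing g"
  shows "mellin_tail (twisted_sum g a c) holomorphic_on UNIV"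
  using twisted_sum_decay[OF assms] by (intro mellin_tail_holomorphic)

section \<open>Poles and residues of F_k\<close>

text \<open>The Mellin tails are entire and only the explicit fractions remain. Both numerators
  contain 1 + (-1)^k, so they vanish for k = 1. The identity also holds at s = 0 and s = 1, where
  both sides use the value 0 for division by zero.\<close>

lemma Fk_decomposition:
  assumes f: "rapidly_decreasing f" and ff: "rapidly_decreasing (fourier f)"
  shows "\<exists>H. H holomorphic_on UNIV \<and>
     (\<forall>s. Fk k f s a c = H s
        + (- (delta_Z c * cexp_pi (- (a * c)) * (1 + (-1) ^ k) * f 0)) / s
        + (delta_Z a * cexp_pi (a * c) * (1 + (-1) ^ k) * fourier f 0) / (s - 1))"
proof -
  define P where "P g s a c = mellin_tail (twisted_sum g a c) s + (-1) ^ k * mellin_tail (twisted_sum (\<lambda>t. g (- t)) a c) s"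
    for g s a c
  have P_hol: "(\<lambda>s. P g s a c) holomorphic_on UNIV" if "rapidly_decreasing g" for g a c
    unfolding P_def
    using mellin_tail_twisted_sum_holomorphic[OF that, of a c]
      mellin_tail_twisted_sum_holomorphic[OF rapidly_decreasing_reflect[OF that], of a c]
    by (intro holomorphic_intros)
  define H where "H s = P f s a c + (-1) ^ k * cexp_pi (- a) * P (fourier f) (1 - s) (1 - c) a" for s
  have "((\<lambda>s. P (fourier f) s (1 - c) a) \<circ> (\<lambda>s. 1 - s)) holomorphic_on UNIV"
    by (rule holomorphic_on_compose_gen[OF _ P_hol[OF ff]]) (auto intro!: holomorphic_intros)
  then have "H holomorphic_on UNIV"
    unfolding H_def o_def using P_hol[OF f] by (intro holomorphic_intros)
  moreover have "Fk k f s a c = H s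
        + (- (delta_Z c * cexp_pi (- (a * c)) * (1 + (-1) ^ k) * f 0)) / s
        + (delta_Z a * cexp_pi (a * c) * (1 + (-1) ^ k) * fourier f 0) / (s - 1)" for s
  proof -
    \<comment> \<open>The phases differ by -2a, which is even when a is an integer, the only case in
      which \<open>delta_Z a\<close> is nonzero.\<close>
    have d: "cexp_pi (- a) * (delta_Z a * cexp_pi (- ((1 - c) * a))) = delta_Z a * cexp_pi (a * c)"
    proof (cases "a \<in> \<int>")
      case True
      then obtain m where m: "a = of_int m" by (auto elim: Ints_cases)
      have "cexp_pi (- a) * cexp_pi (- ((1 - c) * a)) = cexp_pi (a * c)"
        unfolding cexp_pi_add[symmetric] by (rule cexp_pi_eqI[where n = "- m"]) (simp add: m field_simps)
      then show ?thesis by (simp add: mult.left_commute)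
    qed (simp add: delta_Z_def)
    \<comment> \<open>The sign in front of the dual term disappears: it is 1 for even k, and for odd
      k both sides are 0.\<close>
    have k: "(-1) ^ k * (1 + (-1) ^ k) = (1 + (-1) ^ k :: complex)"
      by (simp add: ring_distribs flip: power_mult_distrib)
    have s: "1 / (1 - s) = - (1 / (s - 1))"
      by (metis minus_diff_eq minus_divide_right)
    have "(-1) ^ k * cexp_pi (- a) *
        (delta_Z a * cexp_pi (- ((1 - c) * a)) * (1 + (-1) ^ k) * fourier f 0 * (1 / (1 - s)))
      = (cexp_pi (- a) * (delta_Z a * cexp_pi (- ((1 - c) * a)))) * ((-1) ^ k * (1 + (-1) ^ k))
          * fourier f 0 * (1 / (1 - s))"
      by (simp only: mult_ac)
    also have "\<dots> = - (delta_Z a * cexp_pi (a * c) * (1 + (-1) ^ k) * fourier f 0 / (s - 1))"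
      unfolding d k s by simp
    finally have E: "(-1) ^ k * cexp_pi (- a) *
        (delta_Z a * cexp_pi (- ((1 - c) * a)) * (1 + (-1) ^ k) * fourier f 0 * (1 / (1 - s))) = \<dots>" .
    show ?thesis
      unfolding Fk_eq Phi_eq H_def P_def right_diff_distrib E by simp
  qed
  ultimately show ?thesis by blast
qed

text \<open>The product F(s) (s - p) extends to H(s) (s - p) + r, whose value r at p is the residue.
  A pole forces r to be nonzero, and this numerator then exhibits the order -1. If r = 0, F agrees
  with H at p as well.\<close>

lemma simple_fraction_singularity:
  assumes H: "H holomorphic_on S" and S: "open S" "p \<in> S"
    and F: "\<And>s. s \<in> S \<Longrightarrow> F s = H s + r / (s - p)"
  shows "is_pole F p \<longrightarrow> zorder F p = - 1" and "residue F p = r"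
    and "r = 0 \<Longrightarrow> F holomorphic_on S"
proof -
  show hol: "F holomorphic_on S" if "r = 0"
    by (rule holomorphic_transform[OF H]) (simp add: F that)
  show "residue F p = r"
  proof (rule residue_simple')
    have "(\<lambda>s. H s + r / (s - p)) holomorphic_on S - {p}"
      by (intro holomorphic_intros holomorphic_on_subset[OF H]) auto
    then show "F holomorphic_on S - {p}"
      by (rule holomorphic_transform) (simp add: F)
    have "isCont H p"
      using H S by (meson continuous_on_eq_continuous_at holomorphic_on_imp_continuous_on)
    then have "H \<midarrow>p\<rightarrow> H p" by (simp add: isCont_def)
    then have "(\<lambda>s. H s * (s - p) + r) \<midarrow>p\<rightarrow> H p * (p - p) + r"
      by (intro tendsto_intros)
    moreover have "\<forall>\<^sub>F s in at p. F s * (s - p) = H s * (s - p) + r"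
      using eventually_at_in_open[OF S] by eventually_elim (auto simp: F field_simps)
    ultimately show "(\<lambda>s. F s * (s - p)) \<midarrow>p\<rightarrow> r"
      using tendsto_cong[of "\<lambda>s. F s * (s - p)" "\<lambda>s. H s * (s - p) + r"] by simp
  qed (use S in auto)
  show "is_pole F p \<longrightarrow> zorder F p = - 1"
  proof
    assume "is_pole F p"
    then have "r \<noteq> 0" using hol not_is_pole_holomorphic[OF S] by blast
    show "zorder F p = - 1"
    proof (rule zorder_eqI[OF S])
      show "(\<lambda>s. H s * (s - p) + r) holomorphic_on S" by (intro holomorphic_intros H)
      show "H p * (p - p) + r \<noteq> 0" using \<open>r \<noteq> 0\<close> by simp
      show "F w = (H w * (w - p) + r) * (w - p) powi - 1" if "w \<in> S" "w \<noteq> p" for w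
        using that by (simp add: F field_simps)
    qed
  qed
qed

section \<open>Fourier transforms of Schwartz functions\<close>

lemma rapidly_decreasing_bounded:
  assumes "rapidly_decreasing g"
  obtains C where "\<And>x. norm (g x) \<le> C"
proof -
  obtain C where "\<And>x. \<bar>x\<bar> ^ 0 * norm (g x) \<le> C"
    using assms unfolding rapidly_decreasing_def by blast
  then show thesis using that[of C] by simp
qed

lemma rapidly_decreasing_integrable:
  assumes "rapidly_decreasing g"
  shows "integrable lborel g"
proof -
  have [measurable]: "g \<in> borel_measurable borel"
    using assms by (simp add: rapidly_decreasing_def)
  obtain B where B: "\<And>x. norm (g x) \<le> B"
    using rapidly_decreasing_bounded[OF assms] by blast
  obtain C where C: "\<And>x. \<bar>x\<bar> ^ 2 * norm (g x) \<le> C"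
    using assms unfolding rapidly_decreasing_def by blast
  have "norm (g x) \<le> norm ((B + C) * inverse (1 + x\<^sup>2))" for x
  proof -
    have "norm (g x) * (1 + x\<^sup>2) \<le> B + C"
      using B[of x] C[of x] by (simp add: algebra_simps)
    moreover have "0 < 1 + x\<^sup>2" by (simp add: add_pos_nonneg)
    ultimately have "norm (g x) \<le> (B + C) / (1 + x\<^sup>2)" by (simp add: pos_le_divide_eq)
    then show ?thesis
      unfolding real_norm_def divide_inverse by (rule order_trans[OF _ abs_ge_self])
  qed
  moreover have "integrable lborel (\<lambda>x::real. (B + C) * inverse (1 + x\<^sup>2))"
    using integrable_inverse_1_plus_square by (simp add: set_integrable_def)
  ultimately show ?thesis
    by (intro Bochner_Integration.integrable_bound[where g = g and f = "\<lambda>x. (B + C) * inverse (1 + x\<^sup>2)"]) auto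
qed

lemma cexp_pi_measurable [measurable]: "cexp_pi \<in> borel_measurable borel"
  unfolding cexp_pi_def by (intro borel_measurable_continuous_onI continuous_intros)

lemma fourier_eq: "fourier f y = (LBINT x. cexp_pi (- 2 * (x * y)) * f x)"
  by (simp only: fourier_def exp_eq_cexp_pi)

lemma integrable_cexp_pi_mult:
  assumes "integrable lborel g" "h \<in> borel_measurable borel"
  shows "integrable lborel (\<lambda>x. cexp_pi (h x) * g x)"
proof -
  have [measurable]: "g \<in> borel_measurable borel" "h \<in> borel_measurable borel" using assms by auto
  show ?thesis
    by (rule Bochner_Integration.integrable_bound[OF assms(1)]) (auto simp: norm_mult)
qed

lemma fourier_measurable:
  assumes [measurable]: "f \<in> borel_measurable borel"
  shows "fourier f \<in> borel_measurable borel"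
  unfolding fourier_eq[abs_def] by measurable

lemma norm_fourier_le: "norm (fourier f y) \<le> (LBINT x. norm (f x))"
  unfolding fourier_eq
  by (rule order_trans[OF integral_norm_bound]) (simp add: norm_mult)

lemma schwartz_has_vector_derivative:
  assumes "f \<in> schwartz"
  shows "(nth_vderiv n f has_vector_derivative nth_vderiv (Suc n) f x) (at x)"
proof -
  have "nth_vderiv n f differentiable (at x)" using assms by (simp add: schwartz_def)
  then show ?thesis by (simp add: vector_derivative_works nth_vderiv_def)
qed

lemma schwartz_rapidly_decreasing:
  assumes "f \<in> schwartz"
  shows "rapidly_decreasing (nth_vderiv n f)"
  unfolding rapidly_decreasing_def
proof (intro conjI allI)
  show "nth_vderiv n f \<in> borel_measurable borel"
    using schwartz_has_vector_derivative[OF assms, of n]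
    by (intro borel_measurable_continuous_onI continuous_at_imp_continuous_on ballI)
      (rule has_vector_derivative_continuous)
  fix m
  have "bounded (range (\<lambda>x. x ^ m *\<^sub>R nth_vderiv n f x))" using assms by (simp add: schwartz_def)
  then obtain C where "\<And>x. norm (x ^ m *\<^sub>R nth_vderiv n f x) \<le> C" by (auto simp: bounded_iff)
  then show "\<exists>C. \<forall>x. \<bar>x\<bar> ^ m * norm (nth_vderiv n f x) \<le> C" by (auto simp: power_abs)
qed

lemma rapidly_decreasing_tendsto_0:
  assumes "rapidly_decreasing g"
  shows "(g \<longlongrightarrow> 0) at_top" "(g \<longlongrightarrow> 0) at_bot"
proof -
  obtain C where C: "\<And>x. \<bar>x\<bar> ^ 1 * norm (g x) \<le> C"
    using assms unfolding rapidly_decreasing_def by blast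
  have *: "norm (g x) \<le> C / \<bar>x\<bar>" if "x \<noteq> 0" for x
    using C[of x] that by (simp add: pos_le_divide_eq mult.commute)
  have "((\<lambda>x. C / \<bar>x\<bar>) \<longlongrightarrow> 0) at_top"
    by (rule real_tendsto_divide_at_top[OF tendsto_const filterlim_abs_real])
  then show "(g \<longlongrightarrow> 0) at_top"
    by (rule Lim_null_comparison[rotated]) (rule eventually_mono[OF eventually_gt_at_top[of 0]], rule *, simp)
  have "((\<lambda>x. C / \<bar>x\<bar>) \<longlongrightarrow> 0) at_bot"
  proof (rule real_tendsto_divide_at_top[OF tendsto_const])
    show "filterlim (abs :: real \<Rightarrow> real) at_top at_bot"
      using filterlim_abs_real by (simp add: filterlim_at_bot_mirror)
  qed
  then show "(g \<longlongrightarrow> 0) at_bot"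
    by (rule Lim_null_comparison[rotated]) (rule eventually_mono[OF eventually_gt_at_bot[of 0]], rule *, simp)
qed

text \<open>Integration by parts: the integrand \<open>?d\<close> is the derivative of the phase
  times the n-th derivative of f, which tends to 0 at both ends of the line, so its integral is
  0.\<close>

lemma fourier_derivative:
  assumes f: "f \<in> schwartz"
  shows "fourier (nth_vderiv (Suc n) f) y = 2 * pi * \<i> * y * fourier (nth_vderiv n f) y"
proof -
  let ?D = "nth_vderiv n f" and ?D' = "nth_vderiv (Suc n) f"
  let ?e = "\<lambda>x. cexp_pi (- 2 * (x * y))"
  let ?d = "\<lambda>x. ?e x * ?D' x - 2 * pi * \<i> * y * (?e x * ?D x)"
  have e: "(?e has_vector_derivative - 2 * pi * \<i> * y * ?e x) (at x)" for x
    unfolding exp_eq_cexp_pi(4)[symmetric]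
    by (auto intro!: derivative_eq_intros has_vector_derivative_real_field)
  have D: "(?D has_vector_derivative ?D' x) (at x)" for x
    using f by (rule schwartz_has_vector_derivative)
  have cont: "isCont (nth_vderiv k f) x" for k x
    using schwartz_has_vector_derivative[OF f] has_vector_derivative_continuous by blast
  have int: "integrable lborel (nth_vderiv k f)" for k
    using f by (intro rapidly_decreasing_integrable schwartz_rapidly_decreasing)
  have int1: "integrable lborel (\<lambda>x. ?e x * ?D' x)" "integrable lborel (\<lambda>x. ?e x * ?D x)"
    by (intro integrable_cexp_pi_mult int; measurable)+
  have lim: "((\<lambda>x. ?e x * ?D x) \<longlongrightarrow> 0) F" if "(?D \<longlongrightarrow> 0) F" for F
    by (rule tendsto_norm_zero_cancel) (use tendsto_norm_zero[OF that] in \<open>simp add: norm_mult\<close>)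
  note lims = rapidly_decreasing_tendsto_0[OF schwartz_rapidly_decreasing[OF f, of n], THEN lim]
  have "(LBINT x=-\<infinity>..\<infinity>. ?d x) = 0 - 0"
  proof (rule interval_integral_FTC_integrable)
    show "((\<lambda>x. ?e x * ?D x) has_vector_derivative ?d x) (at x)" for x
      using has_vector_derivative_mult[OF e D] by (simp add: algebra_simps)
    show "isCont ?d x" for x
      using has_vector_derivative_continuous[OF e] by (intro continuous_intros cont)
    show "set_integrable lborel (einterval (- \<infinity>) \<infinity>) ?d"
      using int1 by (simp add: set_integrable_def)
  qed (use lims in \<open>auto simp: ereal_tendsto_simps\<close>)
  then have "(LBINT x. ?d x) = 0"
    by (simp add: interval_lebesgue_integral_def set_lebesgue_integral_def)
  then show ?thesis
    unfolding fourier_eq using int1 by simp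
qed

text \<open>Each factor 2 pi i y is exchanged for a derivative of f, so |y|^m
  |\<open>fourier f y\<close>| is at most the L^1 norm of the m-th derivative.\<close>

lemma fourier_rapidly_decreasing:
  assumes f: "f \<in> schwartz"
  shows "rapidly_decreasing (fourier f)"
  unfolding rapidly_decreasing_def
proof (intro conjI allI)
  have f0: "f = nth_vderiv 0 f" by (simp add: nth_vderiv_def)
  have "f \<in> borel_measurable borel"
    using schwartz_rapidly_decreasing[OF f, of 0] by (simp add: rapidly_decreasing_def flip: f0)
  then show "fourier f \<in> borel_measurable borel" by (rule fourier_measurable)
  fix m
  have eq: "fourier (nth_vderiv m f) y = (2 * pi * \<i> * y) ^ m * fourier f y" for y
  proof (induction m)
    case 0
    then show ?case by (simp flip: f0)
  next
    case (Suc m)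
    then show ?case by (simp add: fourier_derivative[OF f])
  qed
  have "\<bar>y\<bar> ^ m * norm (fourier f y) \<le> (LBINT x. norm (nth_vderiv m f x))" for y
  proof -
    have "\<bar>y\<bar> \<le> norm (2 * pi * \<i> * y)"
      using pi_gt3 by (simp add: norm_mult mult_le_cancel_right1)
    then have "\<bar>y\<bar> ^ m * norm (fourier f y) \<le> norm (2 * pi * \<i> * y) ^ m * norm (fourier f y)"
      by (intro mult_right_mono power_mono) auto
    also have "\<dots> = norm (fourier (nth_vderiv m f) y)"
      by (simp add: eq norm_mult norm_power)
    also have "\<dots> \<le> (LBINT x. norm (nth_vderiv m f x))"
      by (rule norm_fourier_le)
    finally show ?thesis .
  qed
  then show "\<exists>C. \<forall>y. \<bar>y\<bar> ^ m * norm (fourier f y) \<le> C" by blast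
qed

section \<open>Fourier inversion by Gaussian averages\<close>

text \<open>Substituting y = v / (2 pi \<epsilon>) turns the Gaussian into a multiple of the
  standard normal density, whose characteristic function is known. The result is a probability
  density in w of width \<epsilon>, hence an approximate identity.\<close>

lemma integral_cexp_pi_gaussian:
  assumes "\<epsilon> > 0"
  shows "(LBINT y. cexp_pi (- 2 * (w * y)) * exp (- ((2 * pi * \<epsilon> * y)\<^sup>2) / 2))
    = std_normal_density (w / \<epsilon>) / \<epsilon>"
proof -
  let ?k = "1 / (2 * pi * \<epsilon>)"
  have k: "?k > 0" using assms by simp
  have ch: "(LBINT v. std_normal_density v *\<^sub>R cexp_pi (t / pi * v)) = exp (- (t\<^sup>2) / 2)" for t
  proof -
    have "char std_normal_distribution t = (LBINT v. std_normal_density v *\<^sub>R exp (\<i> * of_real (t * v)))"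
      unfolding char_def by (subst integral_density) auto
    moreover have "exp (\<i> * of_real (t * v)) = cexp_pi (t / pi * v)" for v
      by (simp add: cexp_pi_def cis_conv_exp)
    ultimately show ?thesis using fun_cong[OF char_std_normal_distribution, of t] by simp
  qed
  have "(LBINT y. cexp_pi (- 2 * (w * y)) * exp (- ((2 * pi * \<epsilon> * y)\<^sup>2) / 2))
     = ?k *\<^sub>R (LBINT v. cexp_pi (- 2 * (w * (0 + ?k * v))) * exp (- ((2 * pi * \<epsilon> * (0 + ?k * v))\<^sup>2) / 2))"
    using k by (subst lborel_integral_real_affine[where c = ?k and t = 0]) auto
  also have "(\<lambda>v. cexp_pi (- 2 * (w * (0 + ?k * v))) * exp (- ((2 * pi * \<epsilon> * (0 + ?k * v))\<^sup>2) / 2))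
     = (\<lambda>v. sqrt (2 * pi) *\<^sub>R (std_normal_density v *\<^sub>R cexp_pi ((- w / \<epsilon>) / pi * v)))"
  proof
    fix v
    have 1: "2 * pi * \<epsilon> * (0 + ?k * v) = v" using assms by simp
    have 2: "- 2 * (w * (0 + ?k * v)) = (- w / \<epsilon>) / pi * v" using assms by (simp add: field_simps)
    show "cexp_pi (- 2 * (w * (0 + ?k * v))) * exp (- ((2 * pi * \<epsilon> * (0 + ?k * v))\<^sup>2) / 2)
      = sqrt (2 * pi) *\<^sub>R (std_normal_density v *\<^sub>R cexp_pi ((- w / \<epsilon>) / pi * v))"
      unfolding 1 2 by (simp add: std_normal_density_def scaleR_conv_of_real mult.commute)
  qed
  also have "?k *\<^sub>R (LBINT v. sqrt (2 * pi) *\<^sub>R (std_normal_density v *\<^sub>R cexp_pi ((- w / \<epsilon>) / pi * v)))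
     = of_real (?k * sqrt (2 * pi) * exp (- ((w / \<epsilon>)\<^sup>2) / 2))"
    unfolding integral_scaleR_right ch by (simp add: scaleR_conv_of_real)
  also have "?k * sqrt (2 * pi) * exp (- ((w / \<epsilon>)\<^sup>2) / 2) = std_normal_density (w / \<epsilon>) / \<epsilon>"
  proof -
    have "sqrt (2 * pi) * sqrt (2 * pi) = 2 * pi" by simp
    then have "?k * sqrt (2 * pi) = 1 / sqrt (2 * pi) / \<epsilon>"
      using assms by (simp add: field_simps)
    then show ?thesis by (simp add: std_normal_density_def)
  qed
  finally show ?thesis by simp
qed

lemma gaussian_integrable:
  assumes "\<epsilon> > 0"
  shows "integrable lborel (\<lambda>y. exp (- ((2 * pi * \<epsilon> * y)\<^sup>2) / 2))"
proof -
  have "integrable lborel (\<lambda>y. sqrt (2 * pi) * std_normal_density (0 + (2 * pi * \<epsilon>) * y))"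
    using assms by (intro integrable_mult_right lborel_integrable_real_affine) auto
  then show ?thesis by (simp add: std_normal_density_def)
qed

text \<open>The Gaussian factor makes the double integral absolutely convergent, so Fubini applies;
  the inner integral over y is then the density of the preceding lemma.\<close>

lemma fourier_gaussian_average:
  assumes f: "integrable lborel f" and eps: "\<epsilon> > 0"
  shows "(LBINT y. cexp_pi (2 * (x * y)) * exp (- ((2 * pi * \<epsilon> * y)\<^sup>2) / 2) * fourier f y)
    = (LBINT u. std_normal_density u *\<^sub>R f (x + \<epsilon> * u))"
proof -
  have [measurable]: "f \<in> borel_measurable borel" using f by simp
  let ?g = "\<lambda>y. exp (- ((2 * pi * \<epsilon> * y)\<^sup>2) / 2)"
  let ?K = "\<lambda>z y. cexp_pi (- 2 * ((z - x) * y)) * ?g y * f z"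
  have norm_K: "norm (?K z y) = ?g y * norm (f z)" for z y
    by (simp add: norm_mult)
  have gi: "integrable lborel ?g" using eps by (rule gaussian_integrable)
  have K: "integrable (lborel \<Otimes>\<^sub>M lborel) (case_prod ?K)"
  proof (rule lborel_pair.Fubini_integrable)
    show "case_prod ?K \<in> borel_measurable (lborel \<Otimes>\<^sub>M lborel)" by measurable
    show "integrable lborel (\<lambda>z. LBINT y. norm (case_prod ?K (z, y)))"
      unfolding prod.case norm_K using f by simp
    show "AE z in lborel. integrable lborel (\<lambda>y. case_prod ?K (z, y))"
    proof (rule AE_I2)
      fix z
      show "integrable lborel (\<lambda>y. case_prod ?K (z, y))"
        unfolding prod.case
        by (intro integrable_mult_left integrable_cexp_pi_mult integrable_of_real gi) measurable
    qed
  qed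
  have "(LBINT y. cexp_pi (2 * (x * y)) * ?g y * fourier f y) = (LBINT y. LBINT z. ?K z y)"
  proof (rule Bochner_Integration.integral_cong)
    fix y
    have K_eq: "?K z y = (cexp_pi (2 * (x * y)) * ?g y) * (cexp_pi (- 2 * (z * y)) * f z)" for z
    proof -
      have "cexp_pi (- 2 * ((z - x) * y)) = cexp_pi (2 * (x * y)) * cexp_pi (- 2 * (z * y))"
        unfolding cexp_pi_add[symmetric] by (simp add: algebra_simps)
      then show ?thesis by simp
    qed
    show "cexp_pi (2 * (x * y)) * ?g y * fourier f y = (LBINT z. ?K z y)"
      unfolding fourier_eq K_eq by simp
  qed simp
  also have "\<dots> = (LBINT z. LBINT y. ?K z y)"
    by (rule lborel_pair.Fubini_integral[OF K])
  also have "\<dots> = (LBINT z. of_real (std_normal_density ((z - x) / \<epsilon>) / \<epsilon>) * f z)"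
    unfolding integral_mult_left_zero integral_cexp_pi_gaussian[OF eps] ..
  \<comment> \<open>Substitution z = x + \<epsilon> u.\<close>
  also have "\<dots> = \<epsilon> *\<^sub>R (LBINT u. of_real (std_normal_density ((x + \<epsilon> * u - x) / \<epsilon>) / \<epsilon>) * f (x + \<epsilon> * u))"
    using eps by (subst lborel_integral_real_affine[where c = \<epsilon> and t = x]) auto
  also have "\<dots> = (LBINT u. std_normal_density u *\<^sub>R f (x + \<epsilon> * u))"
    unfolding integral_scaleR_right[symmetric] using eps by (simp add: scaleR_conv_of_real)
  finally show ?thesis .
qed

text \<open>
  Both sides of the previous identity converge as \<open>\<epsilon>\<close> tends to \<open>0\<close>: the left one to the inversion
  integral, the right one, an average of \<open>f\<close> against a shrinking Gaussian, to \<open>f x\<close>.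
\<close>

theorem fourier_inversion:
  assumes f: "integrable lborel f" and ff: "integrable lborel (fourier f)"
    and bounded: "\<And>x. norm (f x) \<le> B" and cont: "\<And>x. isCont f x"
  shows "fourier (fourier f) x = f (- x)"
proof -
  have [measurable]: "f \<in> borel_measurable borel" "fourier f \<in> borel_measurable borel"
    using f ff by simp_all
  define \<epsilon> :: "nat \<Rightarrow> real" where "\<epsilon> n = inverse (real (Suc n))" for n
  have pos: "\<epsilon> n > 0" for n by (simp add: \<epsilon>_def)
  have lim: "\<epsilon> \<longlonglongrightarrow> 0" unfolding \<epsilon>_def by (rule LIMSEQ_inverse_real_of_nat)
  \<comment> \<open>The averaging identity is taken at -x: its phase is then that of a second
    forward transform evaluated at x.\<close>
  let ?h = "\<lambda>n y. cexp_pi (2 * (- x * y)) * exp (- ((2 * pi * \<epsilon> n * y)\<^sup>2) / 2) * fourier f y"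
  have "(\<lambda>n. LBINT y. ?h n y) \<longlonglongrightarrow> (LBINT y. cexp_pi (- 2 * (y * x)) * fourier f y)"
  proof (rule integral_dominated_convergence[where w = "\<lambda>y. norm (fourier f y)"])
    show "AE y in lborel. (\<lambda>n. ?h n y) \<longlonglongrightarrow> cexp_pi (- 2 * (y * x)) * fourier f y"
    proof (rule AE_I2)
      fix y
      have "(\<lambda>n. ?h n y) \<longlonglongrightarrow> cexp_pi (2 * (- x * y)) * of_real (exp (- ((2 * pi * 0 * y)\<^sup>2) / 2)) * fourier f y"
        by (intro tendsto_intros lim) simp
      then show "(\<lambda>n. ?h n y) \<longlonglongrightarrow> cexp_pi (- 2 * (y * x)) * fourier f y" by (simp add: mult_ac)
    qed
    show "AE y in lborel. norm (?h n y) \<le> norm (fourier f y)" for n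
      by (rule AE_I2) (simp add: norm_mult mult_left_le_one_le)
  qed (use ff in auto)
  moreover have "(\<lambda>n. LBINT u. std_normal_density u *\<^sub>R f (- x + \<epsilon> n * u)) \<longlonglongrightarrow> (LBINT u. std_normal_density u *\<^sub>R f (- x))"
  \<comment> \<open>The bound B on f makes a multiple of the normal density a dominating function;
    continuity of f gives the pointwise limit.\<close>
  proof (rule integral_dominated_convergence[where w = "\<lambda>u. std_normal_density u * B"])
    show "AE u in lborel. (\<lambda>n. std_normal_density u *\<^sub>R f (- x + \<epsilon> n * u)) \<longlonglongrightarrow> std_normal_density u *\<^sub>R f (- x)"
    proof (rule AE_I2)
      fix u
      have "(\<lambda>n. - x + \<epsilon> n * u) \<longlonglongrightarrow> - x + 0 * u" by (intro tendsto_intros lim)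
      then have "(\<lambda>n. f (- x + \<epsilon> n * u)) \<longlonglongrightarrow> f (- x)"
        by (intro isCont_tendsto_compose[OF cont]) simp
      then show "(\<lambda>n. std_normal_density u *\<^sub>R f (- x + \<epsilon> n * u)) \<longlonglongrightarrow> std_normal_density u *\<^sub>R f (- x)"
        by (intro tendsto_intros)
    qed
    show "AE u in lborel. norm (std_normal_density u *\<^sub>R f (- x + \<epsilon> n * u)) \<le> std_normal_density u * B" for n
      using bounded by (auto intro!: mult_left_mono)
  qed auto
  moreover have "(LBINT u. std_normal_density u *\<^sub>R f (- x)) = f (- x)"
    by simp
  ultimately show ?thesis
    unfolding fourier_gaussian_average[OF f pos] fourier_eq[of "fourier f" x]
    by (auto dest: LIMSEQ_unique)
qed

corollary fourier_fourier_schwartz: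
  assumes f: "f \<in> schwartz"
  shows "fourier (fourier f) = (\<lambda>x. f (- x))"
proof
  fix x
  have f0: "f = nth_vderiv 0 f" by (simp add: nth_vderiv_def)
  have rd: "rapidly_decreasing f"
    using schwartz_rapidly_decreasing[OF f, of 0] by (simp flip: f0)
  obtain B where "\<And>x. norm (f x) \<le> B" using rapidly_decreasing_bounded[OF rd] by blast
  moreover have "isCont f x" for x
    using schwartz_has_vector_derivative[OF f, of 0 x] by (auto simp flip: f0 dest: has_vector_derivative_continuous)
  ultimately show "fourier (fourier f) x = f (- x)"
    using rd fourier_rapidly_decreasing[OF f]
    by (intro fourier_inversion rapidly_decreasing_integrable)
qed

section \<open>Analytic continuation, quasi-periodicity and functional equation of F_k\<close>

theorem theorem4p3:
  fixes a c :: real and f :: "real \<Rightarrow> complex"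
  assumes "f \<in> schwartz"
  shows
    "(\<forall>k\<in>{0,1}. (\<lambda>s. Fk k f s a c) meromorphic_on UNIV) \<and>
     ((\<lambda>s. Fk 1 f s a c) holomorphic_on UNIV \<and>
      (a \<notin> \<int> \<and> c \<notin> \<int> \<longrightarrow> (\<lambda>s. Fk 0 f s a c) holomorphic_on UNIV) \<and>
      (\<lambda>s. Fk 0 f s a c) holomorphic_on (UNIV - {0, 1}) \<and>
      (\<forall>p\<in>{0, 1}. is_pole (\<lambda>s. Fk 0 f s a c) p \<longrightarrow> zorder (\<lambda>s. Fk 0 f s a c) p = -1) \<and>
      (is_pole (\<lambda>s. Fk 0 f s a c) 0 \<longrightarrow> c \<in> \<int>) \<and>
      (is_pole (\<lambda>s. Fk 0 f s a c) 1 \<longrightarrow> a \<in> \<int>) \<and>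
      (c \<notin> \<int> \<longrightarrow> (\<lambda>s. Fk 0 f s a c) analytic_on {0}) \<and>
      (a \<notin> \<int> \<longrightarrow> (\<lambda>s. Fk 0 f s a c) analytic_on {1}) \<and>
      (c \<in> \<int> \<longrightarrow>
         residue (\<lambda>s. Fk 0 f s a c) 0 = - 2 * exp (- of_real pi * \<i> * of_real (a * c)) * f 0) \<and>
      (a \<in> \<int> \<longrightarrow>
         residue (\<lambda>s. Fk 0 f s a c) 1 = 2 * exp (of_real pi * \<i> * of_real (a * c)) * fourier f 0)) \<and>
     (\<forall>k\<in>{0,1}. \<forall>s.
        Fk k f s (a + 1) c = exp (of_real pi * \<i> * of_real c) * Fk k f s a c \<and>
        Fk k f s a (c + 1) = exp (- of_real pi * \<i> * of_real a) * Fk k f s a c) \<and>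
     (\<forall>k\<in>{0,1}. \<forall>s.
        Fk k f s a c =
          (-1) ^ k * exp (- of_real pi * \<i> * of_real a) * Fk k (fourier f) (1 - s) (1 - c) a)"
proof -
  have "f = nth_vderiv 0 f" by (simp add: nth_vderiv_def)
  then have rd: "rapidly_decreasing f" using schwartz_rapidly_decreasing[OF assms, of 0] by simp
  note decomposition = Fk_decomposition[OF rd fourier_rapidly_decreasing[OF assms], where a = a and c = c]
  have functional_equation: "Fk k f s a c = (-1) ^ k * cexp_pi (- a) * Fk k (fourier f) (1 - s) (1 - c) a" for k s
    by (rule Fk_functional_equation[OF fourier_fourier_schwartz[OF assms]])
  have entire_1: "(\<lambda>s. Fk 1 f s a c) holomorphic_on UNIV"
    using decomposition[of 1] by (auto cong: holomorphic_cong)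
  \<comment> \<open>These are the coefficients of the decomposition for k = 0, where 1 + (-1)^k
    equals 2; the deltas encode which of the two poles can occur.\<close>
  define r0 where "r0 = - 2 * delta_Z c * cexp_pi (- (a * c)) * f 0"
  define r1 where "r1 = 2 * delta_Z a * cexp_pi (a * c) * fourier f 0"
  let ?F = "\<lambda>s. Fk 0 f s a c"
  obtain H where H: "H holomorphic_on UNIV" and F: "\<And>s. ?F s = H s + r0 / s + r1 / (s - 1)"
    using decomposition[of 0] by (auto simp: r0_def r1_def mult_ac)
  \<comment> \<open>Each singular point is studied on the complement of the other, where the other
    fraction counts as part of the holomorphic summand.\<close>
  have hol: "(\<lambda>s. H s + r1 / (s - 1)) holomorphic_on - {1}" "(\<lambda>s. H s + r0 / s) holomorphic_on - {0}"
    by (intro holomorphic_intros holomorphic_on_subset[OF H]; auto)+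
  have F0: "?F s = (H s + r1 / (s - 1)) + r0 / (s - 0)" and F1: "?F s = (H s + r0 / s) + r1 / (s - 1)" for s
    by (simp_all add: F)
  note at_0 = simple_fraction_singularity[OF hol(1) open_Compl[OF closed_singleton] _ F0, simplified]
  note at_1 = simple_fraction_singularity[OF hol(2) open_Compl[OF closed_singleton] _ F1, simplified]
  have r0: "r0 = 0" if "c \<notin> \<int>" using that by (simp add: r0_def delta_Z_def)
  have r1: "r1 = 0" if "a \<notin> \<int>" using that by (simp add: r1_def delta_Z_def)
  have analytic_0: "?F analytic_on {0}" if "c \<notin> \<int>"
    using at_0(3)[OF r0[OF that]] by (rule holomorphic_on_imp_analytic_at) auto
  have analytic_1: "?F analytic_on {1}" if "a \<notin> \<int>"
    using at_1(3)[OF r1[OF that]] by (rule holomorphic_on_imp_analytic_at) auto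
  have "?F holomorphic_on UNIV - {0, 1}"
    unfolding F by (intro holomorphic_intros holomorphic_on_subset[OF H]) auto
  moreover have "?F holomorphic_on UNIV" if "a \<notin> \<int> \<and> c \<notin> \<int>"
    unfolding F using H r0 r1 that by simp
  moreover have "?F meromorphic_on UNIV"
    unfolding F using H
    by (intro meromorphic_intros analytic_on_imp_meromorphic_on) (auto simp: analytic_on_open)
  moreover have "(\<lambda>s. Fk 1 f s a c) meromorphic_on UNIV"
    using entire_1 by (intro analytic_on_imp_meromorphic_on) (auto simp: analytic_on_open)
  moreover have "\<not> is_pole ?F 0" if "c \<notin> \<int>"
    using analytic_0[OF that] by (rule analytic_at_imp_no_pole)
  moreover have "\<not> is_pole ?F 1" if "a \<notin> \<int>"
    using analytic_1[OF that] by (rule analytic_at_imp_no_pole)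
  moreover have "residue ?F 0 = - 2 * cexp_pi (- (a * c)) * f 0" if "c \<in> \<int>"
    using at_0(2) that by (simp add: r0_def delta_Z_def)
  moreover have "residue ?F 1 = 2 * cexp_pi (a * c) * fourier f 0" if "a \<in> \<int>"
    using at_1(2) that by (simp add: r1_def delta_Z_def)
  ultimately show ?thesis
    unfolding exp_eq_cexp_pi
    using entire_1 analytic_0 analytic_1 at_0(1) at_1(1) Fk_shift_left Fk_shift_right functional_equation
    by blast
qed

end
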